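(* Let $X$ be a non-empty set and $\alpha$ an equivalence relation on $X$ with equivalence classes $\{A_i:i\in I\}$, and let $Q=\operatorname{Reg}(\mathcal T_X(\alpha))$. Then $$\operatorname{rank}(Q)=\begin{cases}|X| & \text{if } \alpha=\nabla,\\ 2^{\|\alpha\|}\prod_{i\in I}|A_i| & \text{if } \|\alpha\| \text{ is infinite},\\ 3 & \text{if } \alpha=\Delta \text{ and } |X|\ge3 \text{ is finite},\\ 1+\prod_{i\in I}|A_i| & \text{otherwise}.\end{cases}$$
   Context: $\mathcal T_X(\alpha)=\{f:X\to X\mid\ker(f)\supseteq\alpha\}$ under composition, $\ker(f)=\{(x,y):xf=yf\}$; $\operatorname{Reg}(T)$ is the set of regular elements (here a subsemigroup). $\|\alpha\|=|I|$ is the number of $\alpha$-classes. $\Delta=\{(x,x):x\in X\}$ and $\nabla=X\times X$. $\operatorname{rank}(T)$ is the minimum cardinality of a generating set of $T$. *)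

theory Defs
  imports Main "HOL-Library.FuncSet"
begin

unbundle cardinal_syntax


text \<open>Transformations of X are modelled as extensional functions X ->E X (FuncSet).
  Maps are written on the right, so the product f g means "first f, then g".\<close>

definition tcomp :: "'a set \<Rightarrow> ('a \<Rightarrow> 'a) \<Rightarrow> ('a \<Rightarrow> 'a) \<Rightarrow> ('a \<Rightarrow> 'a)" where
  "tcomp X f g = (\<lambda>x\<in>X. g (f x))"

definition T_alpha :: "'a set \<Rightarrow> ('a \<times> 'a) set \<Rightarrow> ('a \<Rightarrow> 'a) set" where
  "T_alpha X \<alpha> = {f \<in> X \<rightarrow>\<^sub>E X. \<forall>(x, y) \<in> \<alpha>. f x = f y}"

definition Reg :: "'a set \<Rightarrow> ('a \<Rightarrow> 'a) set \<Rightarrow> ('a \<Rightarrow> 'a) set" where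
  "Reg X S = {f \<in> S. \<exists>g \<in> S. tcomp X (tcomp X f g) f = f}"

inductive_set sgen :: "'a set \<Rightarrow> ('a \<Rightarrow> 'a) set \<Rightarrow> ('a \<Rightarrow> 'a) set"
  for X :: "'a set" and G :: "('a \<Rightarrow> 'a) set" where
  gen: "f \<in> G \<Longrightarrow> f \<in> sgen X G"
| comp: "f \<in> sgen X G \<Longrightarrow> g \<in> sgen X G \<Longrightarrow> tcomp X f g \<in> sgen X G"

definition rank_is :: "'a set \<Rightarrow> ('a \<Rightarrow> 'a) set \<Rightarrow> 'b set \<Rightarrow> bool" where
  "rank_is X S r \<longleftrightarrow>
     (\<exists>G. G \<subseteq> S \<and> sgen X G = S \<and> card_of G =o card_of r) \<and>
     (\<forall>G. G \<subseteq> S \<and> sgen X G = S \<longrightarrow> card_of r \<le>o card_of G)"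

end

theory Submission
  imports Defs "HOL-Combinatorics.Cycles"
begin

text \<open>
  A map \<open>f\<close> with \<open>ker f \<supseteq> \<alpha>\<close> is regular iff its image meets every class in at most one point. Hence
  regular maps are pairs of a transformation \<open>\<phi>\<close> of the set \<open>I\<close> of classes and a transversal \<open>t\<close>
  (relevant only on the image of \<open>\<phi>\<close>), and the product of \<open>(\<phi>, s)\<close> and \<open>(\<psi>, t)\<close> is
  \<open>(\<psi> \<circ> \<phi>, t)\<close>: the last factor decides the transversal. If the image of a product is a
  full transversal, then it equals the image of the last factor, so a generating set contains
  a map onto every transversal; for more than one class it also contains a map whose
  image misses a class. When \<open>I\<close> is finite this many generators suffice: let the
  permutations attached to the transversals include a long cycle and a transposition, and add a
  fold of one class onto another. In the discrete case there is a single transversal, but two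
  permutations are needed because the symmetric group is not commutative. When \<open>I\<close> is infinite,
  \<open>Q\<close> is uncountable, so its rank is its cardinality.
\<close>

section \<open>Generating permutations and transformations of a finite set\<close>

definition comp_closed :: "('b \<Rightarrow> 'b) set \<Rightarrow> bool" where
  "comp_closed M \<longleftrightarrow> (\<forall>f\<in>M. \<forall>g\<in>M. f \<circ> g \<in> M)"

lemma comp_closedD: "comp_closed M \<Longrightarrow> f \<in> M \<Longrightarrow> g \<in> M \<Longrightarrow> f \<circ> g \<in> M"
  by (simp add: comp_closed_def)

lemma comp_closed_funpow:
  assumes "comp_closed M" "f \<in> M" "0 < n"
  shows "f ^^ n \<in> M"
  using \<open>0 < n\<close>
proof (induct n rule: nat_induct_non_zero)
  case (Suc n)
  then show ?case
    unfolding funpow.simps using assms by (intro comp_closedD)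
qed (use assms in simp)

text \<open>A permutation of finite support has finite order, so its identity and its inverse are
  positive powers of it. The exponent \<open>n > 1\<close> keeps \<open>n - 1\<close> positive;
  closure under composition alone therefore suffices.\<close>

lemma comp_closed_id_inv:
  assumes "comp_closed M" "p \<in> M" "permutation p"
  shows "id \<in> M" "inv p \<in> M"
proof -
  obtain n where n: "p ^^ n = id" "n > 1"
    using permutation_is_nilpotent'[OF assms(3)] by metis
  show "id \<in> M"
    using comp_closed_funpow[OF assms(1,2), of n] n by simp
  have "p ^^ (n - 1) \<circ> p = id"
    using n by (metis Suc_diff_1 funpow_Suc_right less_trans zero_less_one)
  then have "inv p = p ^^ (n - 1)"
    using permutation_bijective[OF assms(3)]
    by (metis bij_is_surj inv_unique_comp comp_assoc comp_id id_comp surj_iff)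
  then show "inv p \<in> M"
    using comp_closed_funpow[OF assms(1,2), of "n - 1"] n by simp
qed

lemma transpose_conj:
  assumes "bij p"
  shows "p \<circ> transpose a b \<circ> inv p = transpose (p a) (p b)"
  using conjugation_of_cycle[of "[a, b]" p] assms
  by (cases "a = b") (simp_all add: bij_is_surj flip: surj_iff)

text \<open>Conjugating the transposition by powers of the cycle gives all adjacent transpositions.\<close>

lemma cycle_transposition_generate:
  assumes M: "comp_closed M" and cs: "distinct cs" "2 \<le> length cs"
    and c: "cycle_of_list cs \<in> M" and t: "transpose (cs ! 0) (cs ! 1) \<in> M"
    and p: "p permutes set cs"
  shows "p \<in> M"
proof -
  let ?c = "cycle_of_list cs"
  have id: "id \<in> M"
    by (rule comp_closed_id_inv(1)[OF M c permutation_of_cycle])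
  have conj: "q \<circ> f \<circ> inv q \<in> M" if "q \<in> M" "f \<in> M" "permutation q" for q f
    using that M by (blast intro: comp_closedD comp_closed_id_inv)
  have adjacent: "transpose (cs ! k) (cs ! Suc k) \<in> M" if "Suc k < length cs" for k
  proof -
    \<comment> \<open>The \<open>k\<close>-th power of the cycle rotates \<open>cs\<close> by
      \<open>k\<close> places; the bound on \<open>k + i\<close> excludes wrapping around.\<close>
    have nth: "(?c ^^ k) (cs ! i) = cs ! (k + i)" if "k + i < length cs" for i
    proof -
      have "(?c ^^ k) (cs ! i) = map (?c ^^ k) cs ! i"
        using that by simp
      also have "\<dots> = rotate k cs ! i"
        by (simp only: cyclic_rotation[OF cs(1)])
      finally show ?thesis
        using that by (simp add: nth_rotate)
    qed
    have "?c ^^ k \<in> M"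
      using id comp_closed_funpow[OF M c] by (cases "k = 0") auto
    moreover have perm: "permutation (?c ^^ k)"
      by (simp add: permutation_funpow permutation_of_cycle)
    ultimately have "?c ^^ k \<circ> transpose (cs ! 0) (cs ! 1) \<circ> inv (?c ^^ k) \<in> M"
      using conj t by blast
    then show ?thesis
      using that nth[of 0] nth[of 1] by (simp add: transpose_conj permutation_bijective[OF perm])
  qed
  have ordered: "transpose (cs ! i) (cs ! j) \<in> M" if "i < j" "j < length cs" for i j
    using that
  proof (induct j)
    case (Suc j)
    show ?case
    proof (cases "i = j")
      case True
      then show ?thesis using adjacent Suc by simp
    next
      case False
      \<comment> \<open>Conjugation by the adjacent swap moves the upper endpoint from position
        \<open>j\<close> to \<open>j + 1\<close> and fixes the lower one, as
        \<open>i < j\<close>.\<close>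
      let ?s = "transpose (cs ! j) (cs ! Suc j)"
      have "?s \<circ> transpose (cs ! i) (cs ! j) \<circ> inv ?s \<in> M"
        using False Suc by (intro conj adjacent) (auto simp: permutation_swap_id)
      moreover have "?s (cs ! i) = cs ! i"
        using False Suc cs(1) by (intro transpose_apply_other) (auto simp: nth_eq_iff_index_eq)
      ultimately show ?thesis
        using transpose_conj[of ?s "cs ! i" "cs ! j"] by simp
    qed
  qed simp
  have "transpose a b \<in> M" if "a \<in> set cs" "b \<in> set cs" "a \<noteq> b" for a b
    using that ordered by (metis in_set_conv_nth linorder_neqE_nat transpose_commute)
  with p finite_set show ?thesis
    by (induct rule: permutes_induct) (auto simp: id M comp_closedD)
qed

text \<open>The clause \<open>c = s\<close> for two points matters later: with a single transversal
  both roles must then be filled by one generator.\<close>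

lemma symmetric_group_two_generators:
  assumes "finite I" "2 \<le> card I"
  obtains c s where "c permutes I" "s permutes I" "card I = 2 \<Longrightarrow> c = s"
    "\<And>M p. comp_closed M \<Longrightarrow> c \<in> M \<Longrightarrow> s \<in> M \<Longrightarrow> p permutes I \<Longrightarrow> p \<in> M"
proof -
  obtain cs where cs: "set cs = I" "distinct cs"
    using finite_distinct_list[OF assms(1)] by blast
  then have len: "length cs = card I"
    using distinct_card by fastforce
  show thesis
  proof (rule that)
    show "cycle_of_list cs permutes I"
      using cycle_permutes[of cs] cs by simp
    show "transpose (cs ! 0) (cs ! 1) permutes I"
      using nth_mem[of 0 cs] nth_mem[of 1 cs] cs(1) len assms(2)
      by (intro permutes_swap_id) auto
    show "cycle_of_list cs = transpose (cs ! 0) (cs ! 1)" if "card I = 2"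
    proof -
      have "length cs = 2"
        using that len by simp
      then obtain a b where "cs = [a, b]"
        by (auto simp: numeral_2_eq_2 length_Suc_conv)
      then show ?thesis by simp
    qed
    show "p \<in> M" if "comp_closed M" "cycle_of_list cs \<in> M"
      "transpose (cs ! 0) (cs ! 1) \<in> M" "p permutes I" for M p
      using cycle_transposition_generate[of M cs p] that cs len assms by simp
  qed
qed

text \<open>Induction on the defect: a map with \<open>f x = f y\<close> that misses \<open>z\<close> factors as the fold of
  \<open>x\<close> onto \<open>y\<close> followed by \<open>f(x := z)\<close>.\<close>

lemma permutations_fold_generate:
  assumes M: "comp_closed M" and perms: "\<And>p. p permutes I \<Longrightarrow> p \<in> M"
    and I: "finite I" and ab: "a \<in> I" "b \<in> I" "a \<noteq> b" and e: "id(a := b) \<in> M"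
    and f: "f ` I \<subseteq> I" "\<And>x. x \<notin> I \<Longrightarrow> f x = x"
  shows "f \<in> M"
proof -
  have fold: "id(x := y) \<in> M" if xy: "x \<in> I" "y \<in> I" "x \<noteq> y" for x y
  proof -
    \<comment> \<open>The first swap takes \<open>x\<close> to \<open>a\<close>; the second takes
      the current place of \<open>y\<close> to \<open>b\<close>. It leaves \<open>a\<close> alone
      because \<open>y \<noteq> x\<close> and \<open>b \<noteq> a\<close>.\<close>
    define p where "p = transpose (transpose x a y) b \<circ> transpose x a"
    have p: "p permutes I"
      unfolding p_def using ab xy
      by (intro permutes_compose permutes_swap_id) (auto simp: transpose_def)
    have pxy: "p x = a" "p y = b"
      using ab xy by (auto simp: p_def transpose_def)
    have "inv p \<circ> (id(a := b) \<circ> p) = id(x := y)"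
    proof
      fix w
      have inj: "inv p (p v) = v" for v
        using permutes_inj[OF p] by simp
      show "(inv p \<circ> (id(a := b) \<circ> p)) w = (id(x := y)) w"
      proof (cases "w = x")
        case True
        then show ?thesis using inj[of y] pxy by simp
      next
        case False
        then have "p w \<noteq> a"
          using pxy(1) permutes_inj[OF p] by (metis injD)
        then show ?thesis using False inj by simp
      qed
    qed
    moreover have "inv p \<circ> (id(a := b) \<circ> p) \<in> M"
      using M perms p permutes_inv[OF p] e by (intro comp_closedD) auto
    ultimately show ?thesis by simp
  qed
  show ?thesis
    using f
  proof (induct "card I - card (f ` I)" arbitrary: f)
    case 0
    then have "f ` I = I"
      using I by (metis card_seteq diff_is_0_eq)
    then have "bij_betw f I I"
      using I by (simp add: bij_betw_def eq_card_imp_inj_on)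
    then have "f permutes I"
      using 0 by (intro bij_imp_permutes)
    then show ?case by (rule perms)
  next
    case (Suc n)
    have less: "card (f ` I) < card I"
      using Suc.hyps(2) by linarith
    then have "\<not> inj_on f I"
      using card_image by fastforce
    then obtain x y where xy: "x \<in> I" "y \<in> I" "x \<noteq> y" "f x = f y"
      by (auto simp: inj_on_def)
    obtain z where z: "z \<in> I" "z \<notin> f ` I"
      using less Suc.prems(1) by (metis less_irrefl subsetI subset_antisym)
    let ?g = "f(x := z)"
    have "?g ` I = insert z (f ` I)"
    proof -
      have "f ` (I - {x}) = f ` I"
        using xy by auto
      then show ?thesis
        using xy by (auto simp: fun_upd_image)
    qed
    then have "n = card I - card (?g ` I)"
      using z I Suc.hyps(2) by simp
    then have "?g \<in> M"
      using Suc.prems z xy by (intro Suc.hyps(1)) auto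
    then have "?g \<circ> id(x := y) \<in> M"
      using fold xy M by (intro comp_closedD) auto
    moreover have "?g \<circ> id(x := y) = f"
      using xy by auto
    ultimately show ?case by simp
  qed
qed

section \<open>Cardinal bounds for generated semigroups\<close>

lemma card_of_Pow_mono:
  assumes "|A| \<le>o |B|"
  shows "|Pow A| \<le>o |Pow B|"
proof -
  obtain f where "inj_on f A" "f ` A \<subseteq> B"
    using assms card_of_ordLeq by metis
  then have "inj_on ((`) f) (Pow A)" "(`) f ` Pow A \<subseteq> Pow B"
    by (auto intro: inj_on_image_Pow)
  then show ?thesis
    using card_of_ordLeq by blast
qed

text \<open>The lower bound applied to \<open>G\<close> itself turns the upper bound into an
  equality, so an explicit generating set only has to be small enough.\<close>

lemma rank_isI:
  assumes "G \<subseteq> S" "sgen X G = S" "|G| \<le>o |r|"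
    and "\<And>G. G \<subseteq> S \<Longrightarrow> sgen X G = S \<Longrightarrow> |r| \<le>o |G|"
  shows "rank_is X S r"
proof -
  have "|G| =o |r|"
    using assms by (simp add: ordIso_iff_ordLeq)
  with assms show ?thesis
    unfolding rank_is_def by blast
qed

text \<open>Every generated element appears at a finite stage \<open>W n\<close>, where each stage
  adds the pairwise products of the previous one. Adjoining the naturals makes the bound infinite
  even for finite \<open>G\<close>, so that it absorbs squares and countable unions.\<close>

lemma card_of_sgen:
  "|sgen X G| \<le>o |G <+> (UNIV :: nat set)|"
proof -
  let ?K = "G <+> (UNIV :: nat set)"
  define W where "W = rec_nat G (\<lambda>_ V. V \<union> (\<lambda>(f, g). tcomp X f g) ` (V \<times> V))"
  have W: "W 0 = G" "W (Suc n) = W n \<union> (\<lambda>(f, g). tcomp X f g) ` (W n \<times> W n)" for n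
    by (simp_all add: W_def)
  have inf: "infinite ?K"
    by (simp add: finite_Plus_iff)
  have cardW: "|W n| \<le>o |?K|" for n
  proof (induct n)
    case 0
    then show ?case by (simp add: W card_of_Plus1)
  next
    case (Suc n)
    have "|W n \<times> W n| \<le>o |?K|"
      by (intro card_of_Times_ordLeq_infinite_Field) (auto simp: inf Suc card_of_card_order_on Field_card_of)
    then have "|(\<lambda>(f, g). tcomp X f g) ` (W n \<times> W n)| \<le>o |?K|"
      by (rule ordLeq_transitive[OF card_of_image])
    then show ?case
      unfolding W by (intro card_of_Un_ordLeq_infinite_Field) (auto simp: inf Suc card_of_card_order_on Field_card_of)
  qed
  have mono: "W m \<subseteq> W n" if "m \<le> n" for m n
    using that by (induct n rule: dec_induct) (auto simp: W)
  have "f \<in> (\<Union>n. W n)" if "f \<in> sgen X G" for f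
    using that
  proof induct
    case (gen f)
    then have "f \<in> W 0" by (simp add: W)
    then show ?case by blast
  next
    case (comp f g)
    then obtain m n where "f \<in> W m" "g \<in> W n" by blast
    then have "f \<in> W (max m n)" "g \<in> W (max m n)"
      using mono[of m "max m n"] mono[of n "max m n"] by auto
    then have "tcomp X f g \<in> W (Suc (max m n))"
      unfolding W by blast
    then show ?case by blast
  qed
  then have "|sgen X G| \<le>o |\<Union>n. W n|"
    by (intro card_of_mono1) blast
  also have "|\<Union>n. W n| \<le>o |?K|"
    by (intro card_of_UNION_ordLeq_infinite ballI cardW inf card_of_Plus2)
  finally show ?thesis .
qed

section \<open>Regular maps as pairs of a class map and a transversal\<close>

locale partitioned_set =
  fixes X :: "'a set" and \<alpha> :: "('a \<times> 'a) set"
  assumes nonempty: "X \<noteq> {}" and equiv: "equiv X \<alpha>"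
begin

abbreviation Q where "Q \<equiv> Reg X (T_alpha X \<alpha>)"
abbreviation I where "I \<equiv> X // \<alpha>"

text \<open>Transversals are encoded as choice functions, so the cardinality of \<open>T\<close> is
  the product of the class sizes.\<close>

definition T where "T = (\<Pi>\<^sub>E A \<in> I. A)"

lemma transversal_mem: "t \<in> T \<Longrightarrow> A \<in> I \<Longrightarrow> t A \<in> A"
  by (auto simp: T_def)

lemma class_in: "x \<in> X \<Longrightarrow> \<alpha> `` {x} \<in> I"
  by (rule quotientI)

lemma self_in_class: "x \<in> X \<Longrightarrow> x \<in> \<alpha> `` {x}"
  by (rule equiv_class_self[OF equiv])

lemma class_subset: "A \<in> I \<Longrightarrow> A \<subseteq> X"
  using equiv by (metis Union_quotient Union_upper)

lemma class_of_member: "A \<in> I \<Longrightarrow> x \<in> A \<Longrightarrow> \<alpha> `` {x} = A"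
  using equiv by (metis Image_singleton_iff equiv_class_eq quotientE)

lemma class_nonempty: "A \<in> I \<Longrightarrow> A \<noteq> {}"
  using equiv self_in_class by (metis empty_iff quotientE)

lemma related_iff: "x \<in> X \<Longrightarrow> y \<in> X \<Longrightarrow> (x, y) \<in> \<alpha> \<longleftrightarrow> \<alpha> `` {x} = \<alpha> `` {y}"
  by (simp add: eq_equiv_class_iff[OF equiv])

lemma related_in: "(x, y) \<in> \<alpha> \<Longrightarrow> x \<in> X \<and> y \<in> X"
  using equiv by (auto simp: equiv_def refl_on_def)

lemma related_refl: "x \<in> X \<Longrightarrow> (x, x) \<in> \<alpha>"
  using self_in_class by simp

text \<open>If \<open>f g f = f\<close> and two values of \<open>f\<close> are related, then
  \<open>g\<close> identifies them, and applying \<open>f\<close> again returns both values, so they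
  agree. Conversely an inverse \<open>g\<close> sends each class met by the image to a preimage of
  its unique image point.\<close>

lemma Q_iff:
  "f \<in> Q \<longleftrightarrow> f \<in> X \<rightarrow>\<^sub>E X \<and> (\<forall>x y. (x, y) \<in> \<alpha> \<longrightarrow> f x = f y)
    \<and> (\<forall>x\<in>X. \<forall>y\<in>X. (f x, f y) \<in> \<alpha> \<longrightarrow> f x = f y)"
  (is "?L \<longleftrightarrow> ?E \<and> ?K \<and> ?R")
proof
  assume ?L
  then obtain g where f: "?E" "?K" and g: "\<And>x y. (x, y) \<in> \<alpha> \<Longrightarrow> g x = g y"
    and fgf: "tcomp X (tcomp X f g) f = f"
    by (fastforce simp: Reg_def T_alpha_def)
  have "f (g (f x)) = f x" if "x \<in> X" for x
    using fun_cong[OF fgf, of x] that by (simp add: tcomp_def)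
  then have ?R
    by (metis g)
  with f show "?E \<and> ?K \<and> ?R" by blast
next
  assume f: "?E \<and> ?K \<and> ?R"
  obtain x0 where x0: "x0 \<in> X" using nonempty by blast
  \<comment> \<open>The choice depends on \<open>y\<close> only through its class, which puts
    \<open>g\<close> into \<open>T_alpha\<close>; classes missed by \<open>f\<close> get the
    arbitrary value \<open>x0\<close>.\<close>
  define g where "g = (\<lambda>y\<in>X. if \<exists>z\<in>X. (f z, y) \<in> \<alpha> then SOME z. z \<in> X \<and> (f z, y) \<in> \<alpha> else x0)"
  have g_pre: "g y \<in> X \<and> (f (g y), y) \<in> \<alpha>" if "z \<in> X" "(f z, y) \<in> \<alpha>" for y z
  proof -
    have "g y = (SOME z. z \<in> X \<and> (f z, y) \<in> \<alpha>)"
      using that related_in by (auto simp: g_def)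
    then show ?thesis
      using someI[of "\<lambda>z. z \<in> X \<and> (f z, y) \<in> \<alpha>"] that by simp
  qed
  have "g \<in> X \<rightarrow>\<^sub>E X"
  proof (rule PiE_I)
    show "g y \<in> X" if "y \<in> X" for y
      using that g_pre x0 by (cases "\<exists>z\<in>X. (f z, y) \<in> \<alpha>") (blast, simp add: g_def)
  qed (simp add: g_def)
  moreover have "g y = g y'" if "(y, y') \<in> \<alpha>" for y y'
  proof -
    have "(f z, y) \<in> \<alpha> \<longleftrightarrow> (f z, y') \<in> \<alpha>" for z
      using that equiv by (meson equivE symE transE)
    then show ?thesis
      using related_in[OF that] by (simp add: g_def)
  qed
  ultimately have g: "g \<in> T_alpha X \<alpha>"
    by (auto simp: T_alpha_def)
  have "tcomp X (tcomp X f g) f = f"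
  proof
    fix x
    show "tcomp X (tcomp X f g) f x = f x"
    proof (cases "x \<in> X")
      case True
      then have "f x \<in> X" using f by auto
      then have "g (f x) \<in> X \<and> (f (g (f x)), f x) \<in> \<alpha>"
        using True g_pre related_refl by blast
      then show ?thesis
        using f True by (simp add: tcomp_def)
    next
      case False
      then show ?thesis
        using f by (auto simp: tcomp_def)
    qed
  qed
  then show ?L
    using f g by (auto simp: Reg_def T_alpha_def)
qed

text \<open>The kernel condition is inherited from the left factor, the image condition from the
  right one.\<close>

lemma Q_closed:
  assumes f: "f \<in> Q" and g: "g \<in> Q"
  shows "tcomp X f g \<in> Q"
proof -
  have fX: "f x \<in> X" if "x \<in> X" for x
    using f that unfolding Q_iff by auto
  have f': "f x = f y" if "(x, y) \<in> \<alpha>" for x y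
    using f that unfolding Q_iff by blast
  show ?thesis
    using g fX unfolding Q_iff by (auto simp: tcomp_def dest: f' related_in)
qed

lemma sgen_subset_Q: "G \<subseteq> Q \<Longrightarrow> sgen X G \<subseteq> Q"
proof
  fix f
  assume "G \<subseteq> Q" "f \<in> sgen X G"
  from this(2,1) show "f \<in> Q"
    by induct (auto intro: Q_closed)
qed

lemma sgen_Q: "sgen X Q = Q"
  using sgen_subset_Q[of Q] by (auto intro: sgen.gen)

text \<open>Coordinates for \<open>Q\<close>. For \<open>\<phi>\<close> mapping \<open>I\<close>
  into itself, only \<open>\<phi>\<close> on \<open>I\<close> and \<open>t\<close> on the image of
  \<open>\<phi>\<close> matter, so a map may have many such pairs.\<close>

definition elem :: "('a set \<Rightarrow> 'a set) \<Rightarrow> ('a set \<Rightarrow> 'a) \<Rightarrow> 'a \<Rightarrow> 'a" where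
  "elem \<phi> t = (\<lambda>x\<in>X. t (\<phi> (\<alpha> `` {x})))"

lemma elem_apply: "x \<in> X \<Longrightarrow> elem \<phi> t x = t (\<phi> (\<alpha> `` {x}))"
  by (simp add: elem_def)

lemma transversal_class: "t \<in> T \<Longrightarrow> A \<in> I \<Longrightarrow> \<alpha> `` {t A} = A"
  using class_of_member transversal_mem by blast

lemma transversal_in: "t \<in> T \<Longrightarrow> A \<in> I \<Longrightarrow> t A \<in> X"
  using class_subset transversal_mem by blast

lemma elem_in_Q:
  assumes "\<phi> ` I \<subseteq> I" "t \<in> T"
  shows "elem \<phi> t \<in> Q"
proof -
  have \<phi>: "\<phi> (\<alpha> `` {x}) \<in> I" if "x \<in> X" for x
    using assms(1) class_in[OF that] by blast
  have "elem \<phi> t \<in> X \<rightarrow>\<^sub>E X"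
    using transversal_in[OF assms(2) \<phi>] by (auto simp: elem_def)
  moreover have "elem \<phi> t x = elem \<phi> t y" if "(x, y) \<in> \<alpha>" for x y
    using that related_in[OF that] related_iff by (simp add: elem_def)
  moreover have "elem \<phi> t x = elem \<phi> t y" if "x \<in> X" "y \<in> X" "(elem \<phi> t x, elem \<phi> t y) \<in> \<alpha>" for x y
  proof -
    have "\<phi> (\<alpha> `` {x}) = \<phi> (\<alpha> `` {y})"
      using that transversal_class[OF assms(2) \<phi>] transversal_in[OF assms(2) \<phi>] related_iff
      by (metis elem_apply)
    then show ?thesis
      using that by (simp add: elem_apply)
  qed
  ultimately show ?thesis
    unfolding Q_iff by blast
qed

text \<open>The representative chosen by \<open>s\<close> lies in the class given by
  \<open>\<phi>\<close>, and the second factor sees only that class; hence \<open>s\<close> is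
  forgotten.\<close>

lemma tcomp_elem:
  assumes "\<phi> ` I \<subseteq> I" "s \<in> T"
  shows "tcomp X (elem \<phi> s) (elem \<psi> t) = elem (\<psi> \<circ> \<phi>) t"
proof
  fix x
  show "tcomp X (elem \<phi> s) (elem \<psi> t) x = elem (\<psi> \<circ> \<phi>) t x"
  proof (cases "x \<in> X")
    case True
    then have "\<phi> (\<alpha> `` {x}) \<in> I"
      using assms(1) class_in by blast
    then show ?thesis
      using True assms(2) by (simp add: tcomp_def elem_apply transversal_in transversal_class)
  qed (simp add: tcomp_def elem_def)
qed

text \<open>Extends the partial transversal \<open>f ` X\<close> to a full one.\<close>

definition extend :: "('a \<Rightarrow> 'a) \<Rightarrow> 'a set \<Rightarrow> 'a" where
  "extend f = (\<lambda>A\<in>I. SOME y. y \<in> A \<and> (y \<in> f ` X \<or> f ` X \<inter> A = {}))"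

lemma extend_spec:
  assumes "A \<in> I"
  shows "extend f A \<in> A" "extend f A \<in> f ` X \<or> f ` X \<inter> A = {}"
proof -
  have "\<exists>y. y \<in> A \<and> (y \<in> f ` X \<or> f ` X \<inter> A = {})"
    using class_nonempty[OF assms] by blast
  from someI_ex[OF this] show "extend f A \<in> A" "extend f A \<in> f ` X \<or> f ` X \<inter> A = {}"
    using assms by (simp_all add: extend_def)
qed

lemma extend_in: "extend f \<in> T"
  using extend_spec(1) by (auto simp: T_def extend_def)

text \<open>\<open>extend\<close> prefers image points, and the image of \<open>f\<close> has only
  one point in the class of \<open>f x\<close>.\<close>

lemma extend_apply:
  assumes f: "f \<in> Q" and x: "x \<in> X"
  shows "extend f (\<alpha> `` {f x}) = f x"
proof -
  have fx: "f x \<in> X" using f x unfolding Q_iff by auto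
  let ?A = "\<alpha> `` {f x}"
  have A: "?A \<in> I" using fx by (rule class_in)
  obtain y where y: "y \<in> X" "extend f ?A = f y"
    using extend_spec(2)[OF A, of f] x self_in_class[OF fx] by blast
  then have "(f x, f y) \<in> \<alpha>"
    using extend_spec(1)[OF A, of f] by simp
  then show ?thesis
    using f x y unfolding Q_iff by metis
qed

lemma Q_elem:
  assumes f: "f \<in> Q"
  obtains \<phi> where "\<phi> ` I \<subseteq> I" "\<And>A. A \<notin> I \<Longrightarrow> \<phi> A = A" "f = elem \<phi> (extend f)"
proof
  \<comment> \<open>\<open>f\<close> is constant on \<open>A\<close>, so the image of
    \<open>A\<close> determines a single class. Being the identity off \<open>I\<close> matches the
    convention of \<open>permutes\<close>.\<close>
  let ?\<phi> = "\<lambda>A. if A \<in> I then \<alpha> `` (f ` A) else A"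
  have cls: "?\<phi> (\<alpha> `` {x}) = \<alpha> `` {f x}" if "x \<in> X" for x
  proof -
    have "f ` (\<alpha> `` {x}) = {f x}"
      using f that self_in_class unfolding Q_iff by auto
    then show ?thesis using class_in[OF that] by simp
  qed
  have fX: "f x \<in> X" if "x \<in> X" for x
    using f that unfolding Q_iff by auto
  show "?\<phi> ` I \<subseteq> I"
    using cls class_in fX by (auto elim!: quotientE)
  show "f = elem ?\<phi> (extend f)"
  proof
    fix x
    show "f x = elem ?\<phi> (extend f) x"
    proof (cases "x \<in> X")
      case True
      then show ?thesis using cls extend_apply[OF f] by (simp add: elem_apply)
    next
      case False
      then show ?thesis using f unfolding Q_iff by (auto simp: elem_def)
    qed
  qed
qed simp

section \<open>Full images and the lower bound\<close>

text \<open>For \<open>f\<close> in \<open>Q\<close> the image is then a complete transversal,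
  equivalently the induced map of classes is onto.\<close>

definition full :: "('a \<Rightarrow> 'a) \<Rightarrow> bool" where
  "full f \<longleftrightarrow> (\<forall>A\<in>I. f ` X \<inter> A \<noteq> {})"

lemma tcomp_image: "tcomp X f g ` X = g ` f ` X"
  by (auto simp: tcomp_def)

lemma full_tcomp:
  assumes "f \<in> Q" "g \<in> Q" "full f"
  shows "tcomp X f g ` X = g ` X"
proof -
  have "g x \<in> g ` f ` X" if x: "x \<in> X" for x
  proof -
    obtain z where "z \<in> X" "f z \<in> \<alpha> `` {x}"
      using assms(3) class_in[OF x] unfolding full_def by blast
    then have "g x = g (f z)"
      using assms(2) unfolding Q_iff by blast
    then show ?thesis using \<open>z \<in> X\<close> by blast
  qed
  moreover have "f ` X \<subseteq> X"
    using assms(1) unfolding Q_iff by auto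
  ultimately show ?thesis
    unfolding tcomp_image by blast
qed

text \<open>The image of \<open>g\<close> has at most one point per class and contains the image of
  the product, which already has one in every class.\<close>

lemma image_full_tcomp:
  assumes "f \<in> Q" "g \<in> Q" "full (tcomp X f g)"
  shows "tcomp X f g ` X = g ` X"
proof
  show sub: "tcomp X f g ` X \<subseteq> g ` X"
    using assms(1) unfolding Q_iff tcomp_image by auto
  show "g ` X \<subseteq> tcomp X f g ` X"
  proof
    fix y assume "y \<in> g ` X"
    then obtain x where x: "x \<in> X" "y = g x" by blast
    then have gx: "g x \<in> X"
      using assms(2) unfolding Q_iff by auto
    obtain w where "w \<in> tcomp X f g ` X" "w \<in> \<alpha> `` {g x}"
      using assms(3) class_in[OF gx] unfolding full_def by blast
    moreover then obtain v where "v \<in> X" "w = g v"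
      using sub by blast
    ultimately have "g x = w"
      using assms(2) x unfolding Q_iff by simp
    with \<open>w \<in> tcomp X f g ` X\<close> show "y \<in> tcomp X f g ` X"
      using x by simp
  qed
qed

text \<open>Passing repeatedly to the last factor keeps both the image and fullness, and ends at a
  generator.\<close>

lemma sgen_full_image:
  assumes "G \<subseteq> Q" "h \<in> sgen X G" "full h"
  obtains g where "g \<in> G" "full g" "g ` X = h ` X"
proof -
  have "\<exists>g\<in>G. g ` X = h ` X"
    using assms(2,3)
  proof induct
    case (comp f g)
    have "f \<in> Q" "g \<in> Q"
      using comp sgen_subset_Q[OF assms(1)] by auto
    then have "tcomp X f g ` X = g ` X"
      using image_full_tcomp comp by blast
    then show ?case
      using comp unfolding full_def by simp
  qed blast
  then show ?thesis
    using that assms(3) unfolding full_def by metis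
qed

lemma sgen_full:
  assumes "G \<subseteq> Q" "\<And>g. g \<in> G \<Longrightarrow> full g" "h \<in> sgen X G"
  shows "full h"
  using assms(3)
proof induct
  case (comp f g)
  then show ?case
    using sgen_subset_Q[OF assms(1)] full_tcomp[of f g] unfolding full_def by (simp add: subset_eq)
qed (rule assms(2))

lemma elem_id_image: "elem id t ` X = t ` I"
proof -
  have "elem id t ` X = t ` (\<lambda>x. \<alpha> `` {x}) ` X"
    unfolding image_image by (intro image_cong) (simp_all add: elem_apply)
  also have "(\<lambda>x. \<alpha> `` {x}) ` X = I"
    by (auto simp: quotient_def)
  finally show ?thesis .
qed

lemma full_elem_id: "t \<in> T \<Longrightarrow> full (elem id t)"
  unfolding full_def elem_id_image by (metis IntI empty_iff imageI transversal_mem)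

lemma transversal_eq:
  assumes "s \<in> T" "t \<in> T" "s ` I = t ` I"
  shows "s = t"
proof (rule PiE_ext[OF assms(1,2)[unfolded T_def]])
  fix A assume A: "A \<in> I"
  then obtain B where B: "B \<in> I" "s A = t B"
    using assms(3) by (metis imageE imageI)
  then have "A = B"
    using A assms transversal_class by metis
  then show "s A = t A" using B by simp
qed

lemma two_classes:
  assumes "\<alpha> \<noteq> X \<times> X"
  obtains A B where "A \<in> I" "B \<in> I" "A \<noteq> B"
proof -
  have "\<alpha> \<subseteq> X \<times> X" using related_in by auto
  then obtain x y where "x \<in> X" "y \<in> X" "(x, y) \<notin> \<alpha>"
    using assms by auto
  then show ?thesis
    using that class_in related_iff by metis
qed

lemma exists_nonfull:
  assumes "\<alpha> \<noteq> X \<times> X"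
  obtains f where "f \<in> Q" "\<not> full f"
proof -
  obtain A B where AB: "A \<in> I" "B \<in> I" "A \<noteq> B"
    using two_classes[OF assms] .
  let ?f = "elem (\<lambda>_. A) (extend id)"
  have "?f \<in> Q"
    using AB by (intro elem_in_Q extend_in) auto
  moreover have "?f ` X \<inter> B = {}"
    using AB transversal_class[OF extend_in, of A id] class_of_member
    by (auto simp: elem_apply)
  ultimately show ?thesis
    using that AB unfolding full_def by blast
qed

lemma generators_nonfull:
  assumes "\<alpha> \<noteq> X \<times> X" "G \<subseteq> Q" "sgen X G = Q"
  obtains g where "g \<in> G" "\<not> full g"
  using assms exists_nonfull sgen_full by metis

lemma rank_lower_bound:
  assumes "\<alpha> \<noteq> X \<times> X" "G \<subseteq> Q" "sgen X G = Q"
  shows "|(UNIV :: unit set) <+> T| \<le>o |G|"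
proof -
  obtain g0 where g0: "g0 \<in> G" "\<not> full g0"
    using generators_nonfull[OF assms] .
  have "\<exists>g. g \<in> G \<and> full g \<and> g ` X = t ` I" if t: "t \<in> T" for t
  proof -
    have "elem id t \<in> sgen X G"
      using t by (simp add: assms(3) elem_in_Q)
    then show ?thesis
      using sgen_full_image[OF assms(2)] full_elem_id[OF t] elem_id_image by metis
  qed
  then obtain k where k: "\<And>t. t \<in> T \<Longrightarrow> k t \<in> G \<and> full (k t) \<and> k t ` X = t ` I"
    by metis
  \<comment> \<open>Distinct transversals have distinct images, and \<open>g0\<close> differs from
    every \<open>k t\<close> because it is not full.\<close>
  let ?k = "case_sum (\<lambda>_. g0) k"
  have "inj_on k T"
    using k transversal_eq by (metis inj_onI)
  then have "inj_on ?k ((UNIV :: unit set) <+> T)"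
    using k g0 by (auto simp: inj_on_def split: sum.splits)
  moreover have "?k ` ((UNIV :: unit set) <+> T) \<subseteq> G"
    using k g0 by auto
  ultimately show ?thesis
    using card_of_ordLeq by blast
qed

section \<open>Generating sets for finitely many classes\<close>

text \<open>The class maps realised in \<open>sgen X G\<close> with some transversal are closed
  under composition, hence include every self-map of \<open>I\<close>. The desired transversal is
  imposed at the end: \<open>\<phi>\<close> is realised as \<open>inv p \<circ> \<phi>\<close>
  followed by the generator with permutation \<open>p\<close> and that transversal.\<close>

lemma generating_set:
  assumes I: "finite I" and AB: "A \<in> I" "B \<in> I" "A \<noteq> B"
    and gens: "\<And>M p. comp_closed M \<Longrightarrow> c \<in> M \<Longrightarrow> s \<in> M \<Longrightarrow> p permutes I \<Longrightarrow> p \<in> M"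
    and perms: "c permutes I" "s permutes I"
    and G: "G \<subseteq> Q"
    and c: "tc \<in> T" "elem c tc \<in> G" and s: "ts \<in> T" "elem s ts \<in> G"
    and e: "te \<in> T" "elem (id(A := B)) te \<in> G"
    and all: "\<And>t. t \<in> T \<Longrightarrow> \<exists>p. p permutes I \<and> elem p t \<in> G"
  shows "sgen X G = Q"
proof
  show "sgen X G \<subseteq> Q"
    by (rule sgen_subset_Q[OF G])
  define M where "M = {\<phi>. \<phi> ` I \<subseteq> I \<and> (\<exists>t\<in>T. elem \<phi> t \<in> sgen X G)}"
  have M: "comp_closed M"
    unfolding comp_closed_def
  proof (intro ballI)
    fix \<psi> \<phi> assume "\<psi> \<in> M" "\<phi> \<in> M"
    then obtain t u where \<phi>: "\<phi> ` I \<subseteq> I" "t \<in> T" "elem \<phi> t \<in> sgen X G"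
      and \<psi>: "\<psi> ` I \<subseteq> I" "u \<in> T" "elem \<psi> u \<in> sgen X G"
      unfolding M_def by blast
    have "elem (\<psi> \<circ> \<phi>) u \<in> sgen X G"
      using sgen.comp[OF \<phi>(3) \<psi>(3)] tcomp_elem[OF \<phi>(1,2)] by simp
    then show "\<psi> \<circ> \<phi> \<in> M"
      unfolding M_def using \<phi> \<psi> by auto
  qed
  have M_I: "\<phi> \<in> M" if "\<phi> ` I \<subseteq> I" "t \<in> T" "elem \<phi> t \<in> G" for \<phi> t
    unfolding M_def using that sgen.gen by blast
  have "c \<in> M" "s \<in> M"
    using M_I[OF _ c] M_I[OF _ s] perms by (simp_all add: permutes_image)
  moreover have "id(A := B) \<in> M"
    using AB by (intro M_I[OF _ e]) auto
  ultimately have maps: "\<phi> \<in> M" if "\<phi> ` I \<subseteq> I" "\<And>C. C \<notin> I \<Longrightarrow> \<phi> C = C" for \<phi>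
    using permutations_fold_generate[OF M gens[OF M] I AB] that by blast
  show "Q \<subseteq> sgen X G"
  proof
    fix f assume "f \<in> Q"
    then obtain \<phi> where \<phi>: "\<phi> ` I \<subseteq> I" "\<And>C. C \<notin> I \<Longrightarrow> \<phi> C = C" "f = elem \<phi> (extend f)"
      using Q_elem by blast
    obtain p where p: "p permutes I" "elem p (extend f) \<in> G"
      using all[OF extend_in] by blast
    have inv: "inv p permutes I"
      using p(1) by (rule permutes_inv)
    have "inv p \<circ> \<phi> \<in> M"
    proof (rule maps)
      show "(inv p \<circ> \<phi>) ` I \<subseteq> I"
        using \<phi>(1) permutes_image[OF inv] by (auto simp: image_subset_iff)
      show "(inv p \<circ> \<phi>) C = C" if "C \<notin> I" for C
        using that \<phi>(2) permutes_not_in[OF inv] by simp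
    qed
    then obtain t where t: "(inv p \<circ> \<phi>) ` I \<subseteq> I" "t \<in> T" "elem (inv p \<circ> \<phi>) t \<in> sgen X G"
      unfolding M_def by blast
    have "tcomp X (elem (inv p \<circ> \<phi>) t) (elem p (extend f)) \<in> sgen X G"
      using t p by (intro sgen.comp) (auto intro: sgen.gen)
    moreover have "p \<circ> (inv p \<circ> \<phi>) = \<phi>"
      using permutes_inv_o(1)[OF p(1)] by (simp flip: comp_assoc)
    ultimately show "f \<in> sgen X G"
      using \<phi>(3) tcomp_elem[OF t(1,2)] by simp
  qed
qed

lemma fold_elem_in_Q: "A \<in> I \<Longrightarrow> B \<in> I \<Longrightarrow> t \<in> T \<Longrightarrow> elem (id(A := B)) t \<in> Q"
  by (intro elem_in_Q) auto

lemma permutes_elem_in_Q: "p permutes I \<Longrightarrow> t \<in> T \<Longrightarrow> elem p t \<in> Q"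
  by (intro elem_in_Q) (auto simp: permutes_image)

text \<open>Besides the fold there is one generator per transversal: \<open>c\<close> goes with
  \<open>t1\<close> and \<open>s\<close> with all others. Both occur if \<open>t2\<close> differs
  from \<open>t1\<close>, and for two classes \<open>c = s\<close> anyway. Indexing the generators
  by the target sum gives the upper bound at once.\<close>

lemma rank_finite_index:
  assumes "\<alpha> \<noteq> X \<times> X" "finite I" and t: "t1 \<in> T" "t2 \<in> T" "card I \<noteq> 2 \<Longrightarrow> t1 \<noteq> t2"
  shows "rank_is X Q ((UNIV :: unit set) <+> T)"
proof -
  obtain A B where AB: "A \<in> I" "B \<in> I" "A \<noteq> B"
    using two_classes[OF assms(1)] .
  then have "2 \<le> card I"
    using assms(2) card_mono[of I "{A, B}"] by simp
  then obtain c s where perms: "c permutes I" "s permutes I" and two: "card I = 2 \<Longrightarrow> c = s"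
    and gens: "\<And>M p. comp_closed M \<Longrightarrow> c \<in> M \<Longrightarrow> s \<in> M \<Longrightarrow> p permutes I \<Longrightarrow> p \<in> M"
    using symmetric_group_two_generators[OF assms(2)] by metis
  define a where "a t = (if t = t1 then c else s)" for t
  have a: "a t permutes I" for t
    using perms by (simp add: a_def)
  have a2: "a t2 = s"
    using t(3) two by (auto simp: a_def)
  let ?g = "case_sum (\<lambda>_::unit. elem (id(A := B)) t1) (\<lambda>t. elem (a t) t)"
  let ?G = "?g ` (UNIV <+> T)"
  have in_G: "elem (a t) t \<in> ?G" if "t \<in> T" for t
    using that by (intro image_eqI[of _ _ "Inr t"]) auto
  have fold_G: "elem (id(A := B)) t1 \<in> ?G"
    by (intro image_eqI[of _ _ "Inl ()"]) auto
  have sub: "?G \<subseteq> Q"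
    using fold_elem_in_Q[OF AB(1,2) t(1)] permutes_elem_in_Q[OF a] by auto
  show ?thesis
  proof (rule rank_isI)
    show "?G \<subseteq> Q" by (rule sub)
    show "sgen X ?G = Q"
    proof (rule generating_set[OF assms(2) AB gens perms sub t(1) _ t(2) _ t(1)])
      show "elem c t1 \<in> ?G" "elem s t2 \<in> ?G"
        using in_G[OF t(1)] in_G[OF t(2)] a2 by (simp_all add: a_def)
    qed (use fold_G in_G a in blast)+
  qed (rule card_of_image, rule rank_lower_bound[OF assms(1)])
qed

section \<open>The discrete case: non-commuting permutations\<close>

lemma tcomp_assoc:
  assumes "f \<in> Q"
  shows "tcomp X (tcomp X f g) h = tcomp X f (tcomp X g h)"
  using assms unfolding Q_iff by (auto simp: tcomp_def fun_eq_iff)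

text \<open>To reach every class the product needs at least \<open>card I\<close> points in the
  image of \<open>f\<close>. These lie in distinct classes, so by finiteness they meet all of
  them.\<close>

lemma full_left_factor:
  assumes "finite I" "f \<in> Q" "full (tcomp X f g)"
  shows "full f"
proof -
  have fX: "f ` X \<subseteq> X"
    using assms(2) unfolding Q_iff by auto
  let ?c = "\<lambda>y. \<alpha> `` {y}"
  have inj: "inj_on ?c (f ` X)"
    using assms(2) fX related_iff unfolding Q_iff inj_on_def by blast
  have sub: "?c ` f ` X \<subseteq> I"
    using fX class_in by blast
  have fin: "finite (f ` X)"
    using inj sub assms(1) by (metis finite_imageD finite_subset)
  have "I \<subseteq> ?c ` g ` f ` X"
  proof
    fix A assume A: "A \<in> I"
    then obtain y where "y \<in> g ` f ` X" "y \<in> A"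
      using assms(3) unfolding full_def tcomp_image by (meson disjoint_iff)
    then show "A \<in> ?c ` g ` f ` X"
      using class_of_member[OF A] by (metis imageI)
  qed
  then have "card I \<le> card (?c ` g ` f ` X)"
    using fin by (intro card_mono) auto
  also have "\<dots> \<le> card (g ` f ` X)"
    using fin by (simp add: card_image_le del: image_image)
  also have "\<dots> \<le> card (f ` X)"
    using fin by (simp add: card_image_le)
  also have "\<dots> = card (?c ` f ` X)"
    using inj by (simp add: card_image)
  finally have image: "?c ` f ` X = I"
    using sub assms(1) by (metis card_seteq)
  show ?thesis
    unfolding full_def
  proof
    fix A assume "A \<in> I"
    then have "A \<in> ?c ` f ` X"
      by (simp only: image)
    then obtain y where y: "A = ?c y" "y \<in> f ` X"
      by (rule imageE)
    then have "y \<in> A"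
      using fX self_in_class by blast
    then show "f ` X \<inter> A \<noteq> {}"
      using y(2) by blast
  qed
qed

text \<open>Both factors of a full product are full, so generators that are not full never enter and
  commutation passes through the product.\<close>

lemma commutes_full_sgen:
  assumes "finite I" "G \<subseteq> Q" "k \<in> Q"
    and "\<And>g. g \<in> G \<Longrightarrow> full g \<Longrightarrow> tcomp X k g = tcomp X g k"
    and "h \<in> sgen X G" "full h"
  shows "tcomp X k h = tcomp X h k"
  using assms(5,6)
proof induct
  case (comp f g)
  have Q: "f \<in> Q" "g \<in> Q"
    using comp sgen_subset_Q[OF assms(2)] by auto
  have "full f"
    using full_left_factor[OF assms(1) Q(1) comp.prems] .
  moreover have "full g"
    using comp.prems image_full_tcomp[OF Q comp.prems] unfolding full_def by simp
  ultimately have "tcomp X k f = tcomp X f k" "tcomp X k g = tcomp X g k"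
    using comp by auto
  then show ?case
    using tcomp_assoc assms(3) Q by metis
qed (use assms(4) in blast)

lemma full_permutes_elem: "p permutes I \<Longrightarrow> t \<in> T \<Longrightarrow> full (elem p t)"
  unfolding full_def
proof
  fix A assume p: "p permutes I" and t: "t \<in> T" and A: "A \<in> I"
  then have "inv p A \<in> I"
    by (simp add: permutes_in_image permutes_inv)
  then obtain x where "x \<in> X" "inv p A = \<alpha> `` {x}"
    by (auto elim: quotientE)
  then have "elem p t x = t A"
    using permutes_inverses(1)[OF p, of A] by (metis elem_apply)
  then show "elem p t ` X \<inter> A \<noteq> {}"
    using \<open>x \<in> X\<close> transversal_mem[OF t A] by (metis IntI empty_iff imageI)
qed

text \<open>Two transpositions sharing the class \<open>B\<close> suffice: the two orders send
  \<open>A\<close> to \<open>C\<close> and to \<open>B\<close>.\<close>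

lemma full_noncommuting:
  assumes "3 \<le> card I"
  obtains f g where "f \<in> Q" "g \<in> Q" "full f" "full g" "tcomp X f g \<noteq> tcomp X g f"
proof -
  obtain A B C where ABC: "A \<in> I" "B \<in> I" "C \<in> I" "A \<noteq> B" "A \<noteq> C" "B \<noteq> C"
    using assms by (auto simp: numeral_3_eq_3 card_le_Suc_iff)
  let ?t = "extend id"
  let ?p = "transpose A B" and ?q = "transpose B C"
  have perms: "?p permutes I" "?q permutes I"
    using ABC by (auto intro: permutes_swap_id)
  obtain x where x: "x \<in> X" "A = \<alpha> `` {x}"
    using ABC(1) by (auto elim: quotientE)
  have "elem (?q \<circ> ?p) ?t x = ?t C" "elem (?p \<circ> ?q) ?t x = ?t B"
    using x(1) ABC by (auto simp: elem_apply simp flip: x(2))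
  moreover have "?t C \<noteq> ?t B"
    using ABC transversal_class[OF extend_in] by metis
  ultimately have "elem (?q \<circ> ?p) ?t \<noteq> elem (?p \<circ> ?q) ?t"
    by auto
  moreover have "tcomp X (elem ?p ?t) (elem ?q ?t) = elem (?q \<circ> ?p) ?t"
    "tcomp X (elem ?q ?t) (elem ?p ?t) = elem (?p \<circ> ?q) ?t"
    using perms by (simp_all add: tcomp_elem extend_in permutes_image)
  ultimately show ?thesis
    using that[of "elem ?p ?t" "elem ?q ?t"] perms
    by (simp add: permutes_elem_in_Q full_permutes_elem extend_in)
qed

text \<open>One generator is not full. With at most one full generator, commutation would spread
  from generators to all full maps, first in one argument and then in the other.\<close>

lemma three_generators_needed:
  assumes "finite I" "3 \<le> card I" "\<alpha> \<noteq> X \<times> X" "G \<subseteq> Q" "sgen X G = Q"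
  shows "|{0, 1, 2 :: nat}| \<le>o |G|"
proof -
  obtain g0 where g0: "g0 \<in> G" "\<not> full g0"
    using generators_nonfull[OF assms(3-5)] .
  have "\<exists>g1\<in>G. \<exists>g2\<in>G. full g1 \<and> full g2 \<and> g1 \<noteq> g2"
  proof (rule ccontr)
    assume "\<not> ?thesis"
    then have "tcomp X g g' = tcomp X g' g" if "g \<in> G" "full g" "g' \<in> G" "full g'" for g g'
      using that by metis
    then have "tcomp X g h = tcomp X h g" if "g \<in> G" "full g" "h \<in> Q" "full h" for g h
      using that commutes_full_sgen[OF assms(1,4), of g h] assms(4,5) by blast
    then have "tcomp X k h = tcomp X h k" if "k \<in> Q" "full k" "h \<in> Q" "full h" for k h
      using that commutes_full_sgen[OF assms(1,4), of k h] assms(5) by metis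
    then show False
      using full_noncommuting[OF assms(2)] by metis
  qed
  then obtain g1 g2 where g: "g1 \<in> G" "g2 \<in> G" "full g1" "full g2" "g1 \<noteq> g2"
    by blast
  let ?k = "\<lambda>n::nat. if n = 0 then g0 else if n = 1 then g1 else g2"
  have "inj_on ?k {0, 1, 2}" "?k ` {0, 1, 2} \<subseteq> G"
    using g0 g by (auto simp: inj_on_def)
  then show ?thesis
    using card_of_ordLeq by blast
qed

lemma rank_discrete:
  assumes "finite I" "3 \<le> card I" "\<And>s t. s \<in> T \<Longrightarrow> t \<in> T \<Longrightarrow> s = t"
  shows "rank_is X Q {0, 1, 2 :: nat}"
proof -
  have nabla: "\<alpha> \<noteq> X \<times> X"
  proof
    assume "\<alpha> = X \<times> X"
    then have "A = X" if "A \<in> I" for A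
      using that by (auto elim: quotientE)
    then have "I \<subseteq> {X}"
      by blast
    then have "card I \<le> 1"
      using card_mono[of "{X}" I] by simp
    then show False using assms(2) by simp
  qed
  obtain A B where AB: "A \<in> I" "B \<in> I" "A \<noteq> B"
    using two_classes[OF nabla] .
  have "2 \<le> card I" using assms(2) by simp
  then obtain c s where perms: "c permutes I" "s permutes I"
    and gens: "\<And>M p. comp_closed M \<Longrightarrow> c \<in> M \<Longrightarrow> s \<in> M \<Longrightarrow> p permutes I \<Longrightarrow> p \<in> M"
    using symmetric_group_two_generators[OF assms(1)] by metis
  let ?t = "extend id"
  note t = extend_in[of id]
  let ?g = "\<lambda>n::nat. elem (if n = 0 then c else if n = 1 then s else id(A := B)) ?t"
  let ?G = "?g ` {0, 1, 2}"
  have sub: "?G \<subseteq> Q"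
    using perms AB t by (auto simp: fold_elem_in_Q permutes_elem_in_Q simp del: id_apply)
  show ?thesis
  proof (rule rank_isI)
    show "?G \<subseteq> Q" by (rule sub)
    show "sgen X ?G = Q"
    proof (rule generating_set[OF assms(1) AB gens perms sub t _ t _ t])
      show "\<exists>p. p permutes I \<and> elem p t' \<in> ?G" if "t' \<in> T" for t'
        using assms(3)[OF that t] perms(1) by (intro exI[of _ c]) auto
    qed auto
  qed (rule card_of_image, rule three_generators_needed[OF assms(1,2) nabla])
qed

section \<open>Infinitely many classes\<close>

text \<open>A regular map is determined by the graph of its class map, a subset of
  \<open>I \<times> I\<close>, together with \<open>extend f\<close>; an infinite \<open>I\<close>
  absorbs its square.\<close>

lemma card_Q_upper:
  assumes "infinite I"
  shows "|Q| \<le>o |Pow I \<times> T|"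
proof -
  define F where "F f = ({(A, B) \<in> I \<times> I. f ` A \<subseteq> B}, extend f)" for f
  have "inj_on F Q"
  proof (rule inj_onI)
    fix f g assume f: "f \<in> Q" and g: "g \<in> Q" and eq: "F f = F g"
    show "f = g"
    proof
      fix x
      show "f x = g x"
      proof (cases "x \<in> X")
        case True
        have fX: "f x \<in> X" using f True unfolding Q_iff by auto
        have "f ` (\<alpha> `` {x}) = {f x}"
          using f True self_in_class unfolding Q_iff by auto
        then have "(\<alpha> `` {x}, \<alpha> `` {f x}) \<in> fst (F f)"
          using class_in[OF True] class_in[OF fX] self_in_class[OF fX] by (simp add: F_def)
        then have "g ` (\<alpha> `` {x}) \<subseteq> \<alpha> `` {f x}"
          unfolding eq by (simp add: F_def)
        then have "g x \<in> \<alpha> `` {f x}"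
          using self_in_class[OF True] by blast
        then have "\<alpha> `` {g x} = \<alpha> `` {f x}"
          using class_of_member class_in[OF fX] by blast
        moreover have "extend f = extend g"
          using eq by (simp add: F_def)
        ultimately show ?thesis
          using extend_apply[OF f True] extend_apply[OF g True] by simp
      next
        case False
        then show ?thesis using f g unfolding Q_iff by (metis PiE_arb)
      qed
    qed
  qed
  moreover have "F ` Q \<subseteq> Pow (I \<times> I) \<times> T"
    by (auto simp: F_def extend_in)
  ultimately have "|Q| \<le>o |Pow (I \<times> I) \<times> T|"
    using card_of_ordLeq by blast
  also have "|Pow (I \<times> I) \<times> T| \<le>o |Pow I \<times> T|"
    using card_of_Times_same_infinite[OF assms]
    by (intro card_of_Times_mono1 card_of_Pow_mono ordIso_imp_ordLeq)
  finally show ?thesis .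
qed

text \<open>Indicator maps: a set of classes is coded by the map taking its members to one class and
  the rest to another.\<close>

lemma card_Pow_le_Q:
  assumes "\<alpha> \<noteq> X \<times> X"
  shows "|Pow I| \<le>o |Q|"
proof -
  obtain A B where AB: "A \<in> I" "B \<in> I" "A \<noteq> B"
    using two_classes[OF assms] .
  let ?t = "extend id"
  define F where "F S = elem (\<lambda>C. if C \<in> S then A else B) ?t" for S
  have "S \<subseteq> S'" if S: "S \<subseteq> I" "S' \<subseteq> I" and eq: "F S = F S'" for S S'
  proof
    fix C assume C: "C \<in> S"
    then obtain x where x: "x \<in> X" "C = \<alpha> `` {x}"
      using S by (auto elim: quotientE)
    have "F S x = ?t A"
      using C x by (simp add: F_def elem_apply)
    moreover have "F S' x = (if C \<in> S' then ?t A else ?t B)"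
      using x by (simp add: F_def elem_apply)
    moreover have "?t A \<noteq> ?t B"
      using AB transversal_class[OF extend_in] by metis
    ultimately show "C \<in> S'"
      using eq by (auto split: if_splits)
  qed
  then have "inj_on F (Pow I)"
    by (metis PowD inj_onI subset_antisym)
  moreover have "F S \<in> Q" for S
    unfolding F_def using AB by (intro elem_in_Q extend_in) auto
  then have "F ` Pow I \<subseteq> Q"
    by blast
  ultimately show ?thesis
    using card_of_ordLeq by blast
qed

lemma card_T_le_Q: "|T| \<le>o |Q|"
proof -
  have "inj_on (elem id) T"
    using elem_id_image transversal_eq by (metis inj_onI)
  moreover have "elem id ` T \<subseteq> Q"
    by (auto intro!: elem_in_Q)
  ultimately show ?thesis
    using card_of_ordLeq by blast
qed

lemma rank_infinite_index:
  assumes inf: "infinite I"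
  shows "rank_is X Q (Pow I \<times> T)"
proof -
  have nabla: "\<alpha> \<noteq> X \<times> X"
  proof
    assume "\<alpha> = X \<times> X"
    then have "I \<subseteq> {X}"
      by (auto elim: quotientE)
    with inf show False
      by (meson finite.emptyI finite.insertI finite_subset)
  qed
  have Pow: "|Pow I| \<le>o |Q|"
    by (rule card_Pow_le_Q[OF nabla])
  have infQ: "infinite Q"
    using card_of_ordLeq_finite[OF Pow] inf by auto
  have le: "|Pow I \<times> T| \<le>o |Q|"
    using infQ Pow card_T_le_Q
    by (intro card_of_Times_ordLeq_infinite_Field) (auto simp: card_of_card_order_on Field_card_of)
  have nat: "|UNIV :: nat set| \<le>o |I|"
    using inf infinite_iff_card_of_nat by blast
  show ?thesis
  proof (rule rank_isI[OF subset_refl sgen_Q card_Q_upper[OF inf]])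
    fix G assume G: "G \<subseteq> Q" "sgen X G = Q"
    then have Q: "|Q| \<le>o |G <+> (UNIV :: nat set)|"
      using card_of_sgen[of X G] by simp
    have "|UNIV :: nat set| \<le>o |G|"
    proof (rule ccontr)
      \<comment> \<open>A countable \<open>G\<close> would make \<open>Q\<close> countable, so the
        power set of \<open>I\<close> would embed in \<open>I\<close>, against Cantor's
        theorem.\<close>
      assume "\<not> |UNIV :: nat set| \<le>o |G|"
      then have "|G| \<le>o |UNIV :: nat set|"
        using ordLeq_total[OF card_of_Well_order card_of_Well_order] by metis
      then have "|G <+> (UNIV :: nat set)| =o |UNIV :: nat set|"
        by (intro card_of_Plus_infinite2) auto
      then have "|Pow I| \<le>o |I|"
        using Pow Q nat by (meson ordLeq_ordIso_trans ordLeq_transitive)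
      then show False
        using card_of_Pow not_ordLess_ordLeq by blast
    qed
    moreover from this have "infinite G"
      using card_of_ordLeq_finite by blast
    ultimately have "|G <+> (UNIV :: nat set)| =o |G|"
      by (intro card_of_Plus_infinite1)
    then show "|Pow I \<times> T| \<le>o |G|"
      using le Q by (meson ordLeq_ordIso_trans ordLeq_transitive)
  qed
qed

section \<open>The universal relation\<close>

text \<open>Here \<open>Q\<close> consists of the constant maps. A product of constants is its last
  factor, so products give nothing new and a generating set must be all of \<open>Q\<close>.\<close>

lemma rank_universal:
  assumes \<alpha>: "\<alpha> = X \<times> X"
  shows "rank_is X Q X"
proof -
  define const where "const y = (\<lambda>x\<in>X. y)" for y :: 'a
  have Q: "Q = const ` X"
  proof
    show "Q \<subseteq> const ` X"
    proof
      fix f assume f: "f \<in> Q"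
      obtain x where x: "x \<in> X" using nonempty by blast
      have "f y = const (f x) y" for y
      proof (cases "y \<in> X")
        case True
        then have "(y, x) \<in> \<alpha>" using x by (simp add: \<alpha>)
        then have "f y = f x" using f unfolding Q_iff by blast
        then show ?thesis using True by (simp add: const_def)
      next
        case False
        then show ?thesis using f unfolding Q_iff by (auto simp: const_def)
      qed
      then have "f = const (f x)" by blast
      moreover have "f x \<in> X" using f x unfolding Q_iff by auto
      ultimately show "f \<in> const ` X" by blast
    qed
    show "const ` X \<subseteq> Q"
      unfolding Q_iff subset_eq by (auto simp: const_def \<alpha>)
  qed
  have "inj_on const X"
  proof (rule inj_onI)
    fix y z assume "const y = const z"
    moreover obtain x where "x \<in> X" using nonempty by blast
    ultimately show "y = z"
      unfolding const_def by (metis restrict_apply')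
  qed
  show ?thesis
  proof (rule rank_isI[OF subset_refl sgen_Q])
    show "|Q| \<le>o |X|"
      unfolding Q by (rule card_of_image)
    fix G assume G: "G \<subseteq> Q" "sgen X G = Q"
    have "f \<in> G" if "f \<in> sgen X G" for f
      using that
    proof induct
      case (comp f g)
      then have "f \<in> const ` X" "g \<in> const ` X"
        using G Q by auto
      then have "tcomp X f g = g"
        by (auto simp: tcomp_def const_def)
      then show ?case using comp by simp
    qed
    then have "const ` X \<subseteq> G"
      using G Q by auto
    then show "|X| \<le>o |G|"
      using \<open>inj_on const X\<close> card_of_ordLeq by blast
  qed
qed

section \<open>Counting transversals and assembling the cases\<close>

lemma discrete_class:
  assumes "\<alpha> = Id_on X" "A \<in> I"
  obtains x where "A = {x}"
  using assms by (auto elim!: quotientE)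

text \<open>Some class has two distinct points; one transversal is altered at that class to choose
  either of them.\<close>

lemma two_transversals:
  assumes "\<alpha> \<noteq> Id_on X"
  obtains t1 t2 where "t1 \<in> T" "t2 \<in> T" "t1 \<noteq> t2"
proof -
  have "Id_on X \<subseteq> \<alpha>" using related_refl by auto
  then obtain x y where xy: "(x, y) \<in> \<alpha>" "(x, y) \<notin> Id_on X"
    using assms by auto
  then have neq: "x \<noteq> y"
    using related_in by blast
  let ?A = "\<alpha> `` {x}"
  have A: "?A \<in> I" using class_in related_in[OF xy(1)] by blast
  have T: "(extend id)(?A := z) \<in> T" if "(x, z) \<in> \<alpha>" for z
    using PiE_fun_upd[of z "\<lambda>A. A" ?A "extend id" I] extend_in[of id] that A by (simp add: T_def insert_absorb)
  have "(extend id)(?A := x) \<noteq> (extend id)(?A := y)"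
    using neq by (metis fun_upd_same)
  with T show ?thesis
    using that xy(1) related_refl related_in by metis
qed

end

text \<open>Cardinal values are represented by sets: a power set times a product of classes, or a
  one-point set added to it. The four hypotheses are mutually exclusive and exhaustive, so no order
  of precedence is lost.\<close>

theorem theorem5p26:
  fixes X :: "'a set" and \<alpha> :: "('a \<times> 'a) set"
  assumes "X \<noteq> {}" and "equiv X \<alpha>"
  defines "Q \<equiv> Reg X (T_alpha X \<alpha>)"
  shows "(\<alpha> = X \<times> X \<longrightarrow> rank_is X Q X)
    \<and> (infinite (X // \<alpha>) \<longrightarrow>
          rank_is X Q (Pow (X // \<alpha>) \<times> (\<Pi>\<^sub>E A \<in> X // \<alpha>. A)))
    \<and> (\<alpha> = Id_on X \<and> finite X \<and> 3 \<le> card X \<longrightarrow> rank_is X Q {0, 1, 2 :: nat})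
    \<and> (\<alpha> \<noteq> X \<times> X \<and> finite (X // \<alpha>) \<and> \<not> (\<alpha> = Id_on X \<and> finite X \<and> 3 \<le> card X) \<longrightarrow>
          rank_is X Q ((UNIV :: unit set) <+> (\<Pi>\<^sub>E A \<in> X // \<alpha>. A)))"
proof -
  interpret partitioned_set X \<alpha>
    using assms by unfold_locales
  have card_discrete: "card (X // \<alpha>) = card X" if "\<alpha> = Id_on X"
  proof -
    have "X // \<alpha> = (\<lambda>x. {x}) ` X"
      using that by (auto simp: quotient_def)
    then show ?thesis by (simp add: card_image)
  qed
  show ?thesis
    unfolding Q_def T_def[symmetric]
  proof (intro conjI impI)
    assume "\<alpha> = X \<times> X"
    then show "rank_is X (Reg X (T_alpha X \<alpha>)) X"
      by (rule rank_universal)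
  next
    assume "infinite (X // \<alpha>)"
    then show "rank_is X (Reg X (T_alpha X \<alpha>)) (Pow (X // \<alpha>) \<times> T)"
      by (rule rank_infinite_index)
  next
    assume \<alpha>: "\<alpha> = Id_on X \<and> finite X \<and> 3 \<le> card X"
    show "rank_is X (Reg X (T_alpha X \<alpha>)) {0, 1, 2 :: nat}"
    proof (rule rank_discrete)
      show "finite (X // \<alpha>)"
        using \<alpha> by (simp add: quotient_def)
      show "3 \<le> card (X // \<alpha>)"
        using \<alpha> card_discrete by simp
      show "s = t" if "s \<in> T" "t \<in> T" for s t
      proof (rule PiE_ext[OF that[unfolded T_def]])
        fix A assume A: "A \<in> X // \<alpha>"
        then obtain x where "A = {x}"
          using discrete_class \<alpha> by blast
        then show "s A = t A"
          using transversal_mem[OF that(1) A] transversal_mem[OF that(2) A] by (metis singletonD)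
      qed
    qed
  next
    assume \<alpha>: "\<alpha> \<noteq> X \<times> X \<and> finite (X // \<alpha>) \<and> \<not> (\<alpha> = Id_on X \<and> finite X \<and> 3 \<le> card X)"
    \<comment> \<open>A discrete relation in this case has exactly two classes, so the same
      transversal can serve twice; any other relation provides two different ones.\<close>
    obtain t1 t2 where "t1 \<in> T" "t2 \<in> T"
      "card (X // \<alpha>) \<noteq> 2 \<Longrightarrow> t1 \<noteq> t2"
    proof (cases "\<alpha> = Id_on X")
      case True
      have "X = \<Union> (X // \<alpha>)"
        using assms(2) by (simp add: Union_quotient)
      moreover have "finite (\<Union> (X // \<alpha>))"
        using \<alpha> discrete_class[OF True] by (metis finite.emptyI finite.insertI finite_Union)
      ultimately have "finite X" by simp
      then have "card (X // \<alpha>) < 3"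
        using \<alpha> True card_discrete by simp
      moreover obtain A B where "A \<in> X // \<alpha>" "B \<in> X // \<alpha>" "A \<noteq> B"
        using two_classes \<alpha> by blast
      then have "2 \<le> card (X // \<alpha>)"
        using \<alpha> card_mono[of "X // \<alpha>" "{A, B}"] by simp
      ultimately show ?thesis
        using that[OF extend_in[of id] extend_in[of id]] by simp
    next
      case False
      then show ?thesis
        using two_transversals that by metis
    qed
    then show "rank_is X (Reg X (T_alpha X \<alpha>)) ((UNIV :: unit set) <+> T)"
      using rank_finite_index \<alpha> by blast
  qed
qed

end
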